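(* Consider the system, costs and MPC feedback $\mu_{\mathrm{f}}$ with prediction horizon $N\in\mathbb{I}_{\ge1}$ and terminal cost $V_{\mathrm{f}}:X\to\mathbb{R}_{\ge0}$ described in the context, and let $\sigma:X\to\mathbb{R}_{\ge0}$. Assume: (Cost detectability) there are $W:X\to\mathbb{R}_{\ge0}$ and constants $\epsilon_{\mathrm{o}}>0$, $\underline{\gamma}_{\mathrm{o}},\overline{\gamma}_{\mathrm{o}}\ge0$ such that for all $(x,u)\in X\times\mathbb{U}$: $\underline{\gamma}_{\mathrm{o}}\sigma(x)\le W(x)\le\overline{\gamma}_{\mathrm{o}}\sigma(x)$ and $W(f(x,u))-W(x)\le-\epsilon_{\mathrm{o}}\sigma(x)+\ell(x,u)$; (Cost controllability) there are constants $\overline\gamma_{\mathrm{f}}\ge0$, $\gamma_{k,\mathrm{f}}\in[0,\overline\gamma_{\mathrm{f}}]$, $k\in\mathbb{I}_{\ge1}$, such that $V_{k,\mathrm{f}}(x)\le\gamma_{k,\mathrm{f}}\sigma(x)$ for all $x\in X$, $k\in\mathbb{I}_{\ge1}$; (Terminal cost) there are constants $\underline c_{\mathrm{f}},\overline c_{\mathrm{f}},\epsilon_{\mathrm{f}}>0$ such that for all $x\in X$: $\underline c_{\mathrm{f}}\sigma(x)\le V_{\mathrm{f}}(x)\le\overline c_{\mathrm{f}}\sigma(x)$, $\min_{u\in\mathbb{U}}\{V_{\mathrm{f}}(f(x,u))+\ell(x,u)\}\le(1+\epsilon_{\mathrm{f}})V_{\mathrm{f}}(x)$, and $\underline c_{\mathrm{f}}\le\frac{\gamma_{1,\mathrm{f}}}{1+\epsilon_{\mathrm{f}}}\le\overline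 c_{\mathrm{f}}$. Let $\alpha_{N,\mathrm{f}}$ be the real number defined by the following linear program in the real variables $\tilde\ell_k$ ($k\in\mathbb{I}_{[0,N-1]}$), $\tilde W_k,\tilde\sigma_k$ ($k\in\mathbb{I}_{[0,N]}$), $\tilde V$, $\tilde V_{\mathrm{f}}$: $$(\alpha_{N,\mathrm{f}}-1)\epsilon_{\mathrm{o}}:=\min_{\tilde\ell,\tilde W,\tilde\sigma,\tilde V,\tilde V_{\mathrm{f}}}\ \sum_{k=1}^{N-1}\tilde\ell_k+\tilde V_{\mathrm{f}}-\tilde V$$ subject to \begin{align*} &\tilde\sigma_0=1,\quad \tilde\ell_k\ge0,\ k\in\mathbb{I}_{[0,N-1]},\quad \tilde V_{\mathrm{f}}\ge0,\quad \tilde\sigma_k\ge0,\ \tilde W_k\ge0,\ k\in\mathbb{I}_{[0,N]},\\ &\underline{\gamma}_{\mathrm{o}}\tilde\sigma_k\le\tilde W_k\le\overline{\gamma}_{\mathrm{o}}\tilde\sigma_k,\ k\in\mathbb{I}_{[0,N]},\\ &\tilde W_{k+1}-\tilde W_k\le-\epsilon_{\mathrm{o}}\tilde\sigma_k+\tilde\ell_k,\ k\in\mathbb{I}_{[0,N-1]},\\ &\textstyle\sum_{j=k}^{N-1}\tilde\ell_j+\tilde V_{\mathrm{f}}\le\gamma_{N-k,\mathrm{f}}\tilde\sigma_k,\ k\in\mathbb{I}_{[0,N-1]},\\ &\textstyle\tilde V\le\sum_{j=1}^{k-1}\tilde\ell_j+\gamma_{N-k+1,\mathrm{f}}\tilde\sigma_k,\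 k\in\mathbb{I}_{[1,N]},\\ &\textstyle\tilde V\le\sum_{j=1}^{N-1}\tilde\ell_j+(1+\epsilon_{\mathrm{f}})\tilde V_{\mathrm{f}},\\ &\underline c_{\mathrm{f}}\tilde\sigma_N\le\tilde V_{\mathrm{f}}\le\overline c_{\mathrm{f}}\tilde\sigma_N. \end{align*} Then, with $Y_{N,\mathrm{f}}:=V_{N,\mathrm{f}}+W$ and $Y_\infty:=V_\infty+W$, for all $x\in X$ $$\epsilon_{\mathrm{o}}\sigma(x)\le Y_{N,\mathrm{f}}(x)\le(\gamma_{N,\mathrm{f}}+\overline\gamma_{\mathrm{o}})\sigma(x),\qquad Y_{N,\mathrm{f}}(f(x,\mu_{\mathrm{f}}(x)))-Y_{N,\mathrm{f}}(x)\le-\epsilon_{\mathrm{o}}\alpha_{N,\mathrm{f}}\sigma(x),$$ and for all $x_0\in X$ $$\alpha_{N,\mathrm{f}}\big(\mathcal{J}^{\mu_{\mathrm{f}}}_\infty(x_0)+W(x_0)\big)\le\left[1+\frac{\overline c_{\mathrm{f}}}{\epsilon_{\mathrm{o}}}\left(1-\frac{\epsilon_{\mathrm{o}}}{\overline\gamma_{\mathrm{f}}+\overline\gamma_{\mathrm{o}}}\right)^N\right]Y_\infty(x_0).$$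
   Context: $\mathbb{I}_{[a,b]}$ (resp. $\mathbb{I}_{\ge a}$) denotes the integers in $[a,b]$ (resp. $\ge a$); empty sums are $0$. System: $x(k+1)=f(x(k),u(k))$ with $X=\mathbb{R}^n$, $\mathbb{U}\subseteq\mathbb{R}^m$, $f:X\times\mathbb{U}\to X$. For an input sequence $u$, $x_u(k,x)$ is the state after $k$ steps from $x_u(0,x)=x$. Stage cost $\ell:X\times\mathbb{U}\to\mathbb{R}_{\ge0}$. For $k\in\mathbb{I}_{\ge1}$: $\mathcal{J}_{k,\mathrm{f}}(x,u)=\sum_{j=0}^{k-1}\ell(x_u(j,x),u(j))+V_{\mathrm{f}}(x_u(k,x))$, $V_{k,\mathrm{f}}(x)=\inf_{u\in\mathbb{U}^k}\mathcal{J}_{k,\mathrm{f}}(x,u)$. Infinite-horizon optimal cost (without terminal cost): $V_\infty(x)=\inf_{u\in\mathbb{U}^\infty}\sum_{k=0}^\infty\ell(x_u(k,x),u(k))$. Minimizers of the optimal control problems are assumed to exist; $u^*_{N,\mathrm{f},x}\in\mathbb{U}^N$ denotes a minimizer of $\mathcal{J}_{N,\mathrm{f}}(x,\cdot)$ and $\mu_{\mathrm{f}}(x):=u^*_{N,\mathrm{f},x}(0)$. Closed loop: $x_{\mu_{\mathrm{f}}}(0)=x_0$, $u_{\mu_{\mathrm{f}}}(k)=\mu_{\mathrm{f}}(x_{\mu_{\mathrm{f}}}(k))$, $x_{\mu_{\mathrm{f}}}(k+1)=f(x_{\mu_{\mathrm{f}}}(k),u_{\mu_{\mathrm{f}}}(k))$;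 $\mathcal{J}^{\mu_{\mathrm{f}}}_\infty(x_0)=\sum_{k=0}^\infty\ell(x_{\mu_{\mathrm{f}}}(k),u_{\mu_{\mathrm{f}}}(k))\in[0,\infty]$. The convention $0\cdot\infty=0$ is used in the performance bound. *)

theory Defs
  imports "HOL-Analysis.Analysis"
begin

text \<open>
  The dynamics, stage cost and terminal cost are total functions; only inputs in the constraint
  set \<open>U\<close> matter.
\<close>

primrec trajectory :: "('x \<Rightarrow> 'u \<Rightarrow> 'x) \<Rightarrow> (nat \<Rightarrow> 'u) \<Rightarrow> 'x \<Rightarrow> nat \<Rightarrow> 'x" where
  "trajectory f u x 0 = x"
| "trajectory f u x (Suc k) = f (trajectory f u x k) (u k)"

text \<open>
  An element of the product of \<open>k\<close> copies of \<open>U\<close> is an extensional function on \<open>{..<k}\<close>.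
\<close>

definition input_seqs :: "'u set \<Rightarrow> nat \<Rightarrow> (nat \<Rightarrow> 'u) set" where
  "input_seqs U k = {..<k} \<rightarrow>\<^sub>E U"

definition finite_cost ::
  "('x \<Rightarrow> 'u \<Rightarrow> 'x) \<Rightarrow> ('x \<Rightarrow> 'u \<Rightarrow> real) \<Rightarrow> ('x \<Rightarrow> real) \<Rightarrow> nat \<Rightarrow> 'x \<Rightarrow> (nat \<Rightarrow> 'u) \<Rightarrow> real" where
  "finite_cost f l Vf k x u =
     (\<Sum>j<k. l (trajectory f u x j) (u j)) + Vf (trajectory f u x k)"

definition finite_value ::
  "('x \<Rightarrow> 'u \<Rightarrow> 'x) \<Rightarrow> 'u set \<Rightarrow> ('x \<Rightarrow> 'u \<Rightarrow> real) \<Rightarrow> ('x \<Rightarrow> real) \<Rightarrow> nat \<Rightarrow> 'x \<Rightarrow> real" where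
  "finite_value f U l Vf k x = (INF u\<in>input_seqs U k. finite_cost f l Vf k x u)"

text \<open>
  Infinite-horizon costs may be infinite. They are \<open>ereal\<close>-valued rather than \<open>ennreal\<close>-valued
  because they get multiplied by a possibly negative real number; on \<open>ereal\<close> one has
  \<open>0 * \<infinity> = 0\<close>.
\<close>

definition infinite_cost ::
  "('x \<Rightarrow> 'u \<Rightarrow> 'x) \<Rightarrow> ('x \<Rightarrow> 'u \<Rightarrow> real) \<Rightarrow> 'x \<Rightarrow> (nat \<Rightarrow> 'u) \<Rightarrow> ereal" where
  "infinite_cost f l x u = (\<Sum>k. ereal (l (trajectory f u x k) (u k)))"

definition infinite_value ::
  "('x \<Rightarrow> 'u \<Rightarrow> 'x) \<Rightarrow> 'u set \<Rightarrow> ('x \<Rightarrow> 'u \<Rightarrow> real) \<Rightarrow> 'x \<Rightarrow> ereal" where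
  "infinite_value f U l x = (INF u\<in>UNIV \<rightarrow> U. infinite_cost f l x u)"

primrec closed_loop :: "('x \<Rightarrow> 'u \<Rightarrow> 'x) \<Rightarrow> ('x \<Rightarrow> 'u) \<Rightarrow> 'x \<Rightarrow> nat \<Rightarrow> 'x" where
  "closed_loop f \<mu> x0 0 = x0"
| "closed_loop f \<mu> x0 (Suc k) = f (closed_loop f \<mu> x0 k) (\<mu> (closed_loop f \<mu> x0 k))"

definition closed_loop_cost ::
  "('x \<Rightarrow> 'u \<Rightarrow> 'x) \<Rightarrow> ('x \<Rightarrow> 'u \<Rightarrow> real) \<Rightarrow> ('x \<Rightarrow> 'u) \<Rightarrow> 'x \<Rightarrow> ereal" where
  "closed_loop_cost f l \<mu> x0 =
     (\<Sum>k. ereal (l (closed_loop f \<mu> x0 k) (\<mu> (closed_loop f \<mu> x0 k))))"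

definition mpc_feedback :: "('x \<Rightarrow> nat \<Rightarrow> 'u) \<Rightarrow> 'x \<Rightarrow> 'u" where
  "mpc_feedback ustar x = ustar x 0"

text \<open>
  The decision variables \<open>l\<close>, \<open>W\<close>, \<open>s\<close> of the linear program are sequences of which only the
  entries \<open>l 0, \<dots>, l (N - 1)\<close> and \<open>W 0, \<dots>, W N\<close>, \<open>s 0, \<dots>, s N\<close> are used.
\<close>

definition lp_feasible ::
  "nat \<Rightarrow> real \<Rightarrow> real \<Rightarrow> real \<Rightarrow> (nat \<Rightarrow> real) \<Rightarrow> real \<Rightarrow> real \<Rightarrow> real \<Rightarrow>
   (nat \<Rightarrow> real) \<Rightarrow> (nat \<Rightarrow> real) \<Rightarrow> (nat \<Rightarrow> real) \<Rightarrow> real \<Rightarrow> real \<Rightarrow> bool" where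
  "lp_feasible N eps_o gam_o_low gam_o_up gam_f c_low c_up eps_f l W s V Vf \<longleftrightarrow>
     s 0 = 1 \<and>
     (\<forall>k\<in>{0..<N}. l k \<ge> 0) \<and>
     Vf \<ge> 0 \<and>
     (\<forall>k\<in>{0..N}. s k \<ge> 0 \<and> W k \<ge> 0) \<and>
     (\<forall>k\<in>{0..N}. gam_o_low * s k \<le> W k \<and> W k \<le> gam_o_up * s k) \<and>
     (\<forall>k\<in>{0..<N}. W (k + 1) - W k \<le> - eps_o * s k + l k) \<and>
     (\<forall>k\<in>{0..<N}. (\<Sum>j=k..<N. l j) + Vf \<le> gam_f (N - k) * s k) \<and>
     (\<forall>k\<in>{1..N}. V \<le> (\<Sum>j=1..<k. l j) + gam_f (N - k + 1) * s k) \<and>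
     V \<le> (\<Sum>j=1..<N. l j) + (1 + eps_f) * Vf \<and>
     c_low * s N \<le> Vf \<and> Vf \<le> c_up * s N"

definition lp_objective_values ::
  "nat \<Rightarrow> real \<Rightarrow> real \<Rightarrow> real \<Rightarrow> (nat \<Rightarrow> real) \<Rightarrow> real \<Rightarrow> real \<Rightarrow> real \<Rightarrow> real set" where
  "lp_objective_values N eps_o gam_o_low gam_o_up gam_f c_low c_up eps_f =
     {(\<Sum>k=1..<N. l k) + Vf - V | l W s V Vf.
        lp_feasible N eps_o gam_o_low gam_o_up gam_f c_low c_up eps_f l W s V Vf}"

definition is_minimum :: "real set \<Rightarrow> real \<Rightarrow> bool" where
  "is_minimum S v \<longleftrightarrow> v \<in> S \<and> (\<forall>w\<in>S. v \<le> w)"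

end

theory Submission imports Defs begin

text \<open>
  The linear program relaxes the search for the worst optimal trajectory of length \<open>N\<close>: divided by \<open>\<sigma> x\<close>, the costs and states along such a trajectory form a
  feasible point (\<open>optimal_trajectory_lp_feasible\<close>). Its minimum therefore bounds how far the value
  function is from decreasing by the full stage cost:
  \<open>V\<^sub>N (f x (\<mu> x)) \<le> V\<^sub>N x - l x (\<mu> x) + (1 - \<alpha>) * \<epsilon> * \<sigma> x\<close> (\<open>lp_decrease\<close>). Adding the detectability
  inequality gives the decrease of \<open>V\<^sub>N + W\<close>.

  For the performance bound, the feasible point that vanishes after time \<open>0\<close> shows \<open>\<alpha> \<le> 1\<close>. Detectability
  then also serves to replace the error term \<open>(1 - \<alpha>) * \<epsilon> * \<sigma> x\<close> by stage cost and a decrease of \<open>W\<close>, and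
  the relaxed dynamic programming inequality sums up along the closed loop to
  \<open>\<alpha> * (J + W) \<le> V\<^sub>N + W\<close> (\<open>closed_loop_cost_bound\<close>). It remains to compare \<open>V\<^sub>N + W\<close> with its
  infinite-horizon counterpart (\<open>finite_value_le_infinite_value\<close>): along a nearly optimal infinite input,
  the remaining cost plus \<open>W\<close> contracts by the factor \<open>1 - \<epsilon> / (\<gamma>up + \<gamma>o)\<close> in each step, up to a small
  error, so the terminal cost after \<open>N\<close> steps is exponentially small.

  The contraction needs the bound \<open>(\<gamma>up + \<gamma>o) * \<sigma>\<close> for the infinite-horizon value plus \<open>W\<close>
  (\<open>infinite_value_le\<close>), whereas controllability bounds finite-horizon values, whose optimal inputs need
  not converge to an infinite one. A closed loop with a very long horizon bridges this gap:
  \<open>long_horizon_decrease\<close> makes the error term in the relaxed dynamic programming inequality arbitrarily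
  small, and the same summation bounds the cost of an actual infinite trajectory.
\<close>

section \<open>Finite-horizon optimal control\<close>

lemma trajectory_cong:
  assumes "\<And>j. j < k \<Longrightarrow> u j = v j"
  shows "trajectory f u x k = trajectory f v x k"
  using assms by (induction k) auto

lemma trajectory_add:
  "trajectory f u x (m + k) = trajectory f (\<lambda>j. u (m + j)) (trajectory f u x m) k"
  by (induction k) auto

lemma finite_cost_cong:
  assumes "\<And>j. j < k \<Longrightarrow> u j = v j"
  shows "finite_cost f l Vf k x u = finite_cost f l Vf k x v"
proof -
  have "trajectory f u x j = trajectory f v x j" if "j \<le> k" for j
    using assms that by (intro trajectory_cong) auto
  then show ?thesis
    using assms unfolding finite_cost_def by auto
qed

lemma sum_shift_lessThan:
  fixes a :: "nat \<Rightarrow> 'a::comm_monoid_add"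
  shows "(\<Sum>j<m + k. a j) = (\<Sum>j<m. a j) + (\<Sum>j<k. a (m + j))"
  by (induction k) (auto simp: add.assoc)

lemma finite_cost_add:
  "finite_cost f l Vf (m + k) x u =
     (\<Sum>j<m. l (trajectory f u x j) (u j)) +
     finite_cost f l Vf k (trajectory f u x m) (\<lambda>j. u (m + j))"
  unfolding finite_cost_def by (simp add: sum_shift_lessThan trajectory_add add.assoc)

locale optimal_control =
  fixes f :: "'x \<Rightarrow> 'u \<Rightarrow> 'x" and U :: "'u set"
    and l :: "'x \<Rightarrow> 'u \<Rightarrow> real" and Vf :: "'x \<Rightarrow> real"
  assumes stage_cost_nonneg: "u \<in> U \<Longrightarrow> 0 \<le> l x u"
    and terminal_cost_nonneg: "0 \<le> Vf x"
    and minimizer_exists: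
      "1 \<le> k \<Longrightarrow> \<exists>u. is_arg_min (finite_cost f l Vf k x) (\<lambda>u. u \<in> input_seqs U k) u"
begin

abbreviation value_fn :: "nat \<Rightarrow> 'x \<Rightarrow> real" where
  "value_fn k x \<equiv> finite_value f U l Vf k x"

abbreviation optimal_input :: "nat \<Rightarrow> 'x \<Rightarrow> (nat \<Rightarrow> 'u) \<Rightarrow> bool" where
  "optimal_input k x u \<equiv> is_arg_min (finite_cost f l Vf k x) (\<lambda>u. u \<in> input_seqs U k) u"

lemma optimal_input_in:
  assumes "optimal_input k x u" "j < k"
  shows "u j \<in> U"
  using assms by (auto simp: is_arg_min_def input_seqs_def)

lemma finite_cost_nonneg:
  assumes "\<And>j. j < k \<Longrightarrow> u j \<in> U"
  shows "0 \<le> finite_cost f l Vf k x u"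
  unfolding finite_cost_def
  by (intro add_nonneg_nonneg sum_nonneg) (auto simp: assms stage_cost_nonneg terminal_cost_nonneg)

lemma value_fn_le_cost:
  assumes "\<And>j. j < k \<Longrightarrow> u j \<in> U"
  shows "value_fn k x \<le> finite_cost f l Vf k x u"
proof -
  have "bdd_below (finite_cost f l Vf k x ` input_seqs U k)"
    by (rule bdd_belowI[of _ 0]) (auto simp: input_seqs_def intro!: finite_cost_nonneg)
  moreover have "restrict u {..<k} \<in> input_seqs U k"
    using assms by (auto simp: input_seqs_def)
  ultimately have "value_fn k x \<le> finite_cost f l Vf k x (restrict u {..<k})"
    unfolding finite_value_def by (rule cINF_lower)
  also have "\<dots> = finite_cost f l Vf k x u"
    by (rule finite_cost_cong) auto
  finally show ?thesis .
qed

lemma value_fn_optimal: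
  assumes "optimal_input k x u"
  shows "value_fn k x = finite_cost f l Vf k x u"
proof (rule antisym)
  show "value_fn k x \<le> finite_cost f l Vf k x u"
    using assms by (intro value_fn_le_cost) (rule optimal_input_in)
  show "finite_cost f l Vf k x u \<le> value_fn k x"
    using assms unfolding finite_value_def
    by (intro cINF_greatest) (auto simp: is_arg_min_def not_less)
qed

lemma value_fn_nonneg:
  assumes "1 \<le> k"
  shows "0 \<le> value_fn k x"
proof -
  obtain u where u: "optimal_input k x u"
    using minimizer_exists[OF assms] by blast
  then show ?thesis
    by (auto simp: value_fn_optimal intro!: finite_cost_nonneg dest: optimal_input_in)
qed

text \<open>
  Half of the dynamic programming principle: an arbitrary prefix may be continued by an optimal
  input for the remaining horizon.
\<close>
lemma value_fn_concat:
  assumes u: "\<And>j. j < m \<Longrightarrow> u j \<in> U" and k: "1 \<le> k"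
  shows "value_fn (m + k) x \<le>
    (\<Sum>j<m. l (trajectory f u x j) (u j)) + value_fn k (trajectory f u x m)"
proof -
  obtain v where v: "optimal_input k (trajectory f u x m) v"
    using minimizer_exists[OF k] by blast
  define w where "w = (\<lambda>j. if j < m then u j else v (j - m))"
  have traj: "trajectory f w x j = trajectory f u x j" if "j \<le> m" for j
    using that by (intro trajectory_cong) (auto simp: w_def)
  have "value_fn (m + k) x \<le> finite_cost f l Vf (m + k) x w"
    using u optimal_input_in[OF v] by (intro value_fn_le_cost) (auto simp: w_def)
  also have "\<dots> = (\<Sum>j<m. l (trajectory f u x j) (u j))
      + finite_cost f l Vf k (trajectory f u x m) v"
    unfolding finite_cost_add by (auto simp: traj) (auto simp: w_def)
  finally show ?thesis
    using value_fn_optimal[OF v] by simp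
qed

lemma optimal_tail:
  assumes u: "optimal_input (m + k) x u" and k: "1 \<le> k"
  shows "finite_cost f l Vf k (trajectory f u x m) (\<lambda>j. u (m + j))
    = value_fn k (trajectory f u x m)"
proof (rule antisym)
  have "value_fn (m + k) x \<le>
      (\<Sum>j<m. l (trajectory f u x j) (u j)) + value_fn k (trajectory f u x m)"
    using optimal_input_in[OF u] k by (intro value_fn_concat) auto
  then show "finite_cost f l Vf k (trajectory f u x m) (\<lambda>j. u (m + j))
      \<le> value_fn k (trajectory f u x m)"
    by (simp add: value_fn_optimal[OF u] finite_cost_add)
  show "value_fn k (trajectory f u x m)
      \<le> finite_cost f l Vf k (trajectory f u x m) (\<lambda>j. u (m + j))"
    using optimal_input_in[OF u] by (intro value_fn_le_cost) auto
qed

text \<open>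
  The candidate inputs behind all estimates of the cost at the successor state: follow the old
  optimal input up to time \<open>Suc m\<close>, then re-optimize over the horizon that is left.
\<close>
lemma value_fn_successor_le:
  assumes u: "optimal_input N x u" and m: "Suc m \<le> N"
  shows "value_fn N (f x (u 0)) \<le>
    (\<Sum>j=1..<Suc m. l (trajectory f u x j) (u j)) + value_fn (N - m) (trajectory f u x (Suc m))"
proof -
  have shift: "trajectory f (\<lambda>j. u (Suc j)) (f x (u 0)) j = trajectory f u x (Suc j)" for j
    using trajectory_add[of f u x 1 j] by simp
  have "value_fn (m + (N - m)) (f x (u 0)) \<le>
      (\<Sum>j<m. l (trajectory f (\<lambda>j. u (Suc j)) (f x (u 0)) j) (u (Suc j)))
      + value_fn (N - m) (trajectory f (\<lambda>j. u (Suc j)) (f x (u 0)) m)"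
    using m optimal_input_in[OF u] by (intro value_fn_concat) auto
  moreover have "(\<Sum>j<m. l (trajectory f u x (Suc j)) (u (Suc j)))
      = (\<Sum>j=1..<Suc m. l (trajectory f u x j) (u j))"
    using sum.shift_bounds_Suc_ivl[of "\<lambda>j. l (trajectory f u x j) (u j)" 0 m]
    by (simp add: lessThan_atLeast0)
  ultimately show ?thesis
    using m by (simp add: shift del: trajectory.simps)
qed

lemma infinite_cost_sums:
  assumes "(\<lambda>k. l (trajectory f u x k) (u k)) sums s"
  shows "infinite_cost f l x u = ereal s"
  using assms unfolding infinite_cost_def by (metis sums_ereal sums_unique)

lemma infinite_cost_lessE:
  assumes "u \<in> UNIV \<rightarrow> U" "infinite_cost f l x u < ereal c"
  obtains s where "(\<lambda>k. l (trajectory f u x k) (u k)) sums s" "s < c"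
proof -
  have nonneg: "0 \<le> l (trajectory f u x k) (u k)" for k
    using assms(1) by (auto intro: stage_cost_nonneg)
  have "infinite_cost f l x u \<noteq> \<infinity>"
    using assms(2) by auto
  then have "summable (\<lambda>k. l (trajectory f u x k) (u k))"
    unfolding infinite_cost_def using nonneg by (intro summable_ereal)
  then obtain s where s: "(\<lambda>k. l (trajectory f u x k) (u k)) sums s"
    by (auto simp: summable_def)
  then show thesis
    using that assms(2) infinite_cost_sums[OF s] by auto
qed

lemma infinite_value_lessE:
  assumes "infinite_value f U l x < ereal c"
  obtains u s where "u \<in> UNIV \<rightarrow> U" "(\<lambda>k. l (trajectory f u x k) (u k)) sums s" "s < c"
proof -
  obtain u where u: "u \<in> UNIV \<rightarrow> U" "infinite_cost f l x u < ereal c"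
    using assms unfolding infinite_value_def INF_less_iff by auto
  then obtain s where "(\<lambda>k. l (trajectory f u x k) (u k)) sums s" "s < c"
    by (rule infinite_cost_lessE)
  then show thesis
    using that u(1) by blast
qed

lemma infinite_value_nonneg: "0 \<le> infinite_value f U l x"
  unfolding infinite_value_def infinite_cost_def
  by (intro INF_greatest suminf_0_le) (auto intro: stage_cost_nonneg)

lemma infinite_value_le_closed_loop_cost:
  assumes "\<And>x. \<kappa> x \<in> U"
  shows "infinite_value f U l x \<le> closed_loop_cost f l \<kappa> x"
proof -
  define u where "u = (\<lambda>k. \<kappa> (closed_loop f \<kappa> x k))"
  have "trajectory f u x k = closed_loop f \<kappa> x k" for k
    by (induction k) (auto simp: u_def)
  then have "infinite_cost f l x u = closed_loop_cost f l \<kappa> x"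
    by (simp add: infinite_cost_def closed_loop_cost_def u_def)
  moreover have "u \<in> UNIV \<rightarrow> U"
    using assms by (auto simp: u_def)
  ultimately show ?thesis
    unfolding infinite_value_def by (metis INF_lower)
qed

end

section \<open>Cost detectability and cost controllability\<close>

locale detectable_controllable = optimal_control f U l Vf
  for f :: "'x \<Rightarrow> 'u \<Rightarrow> 'x" and U :: "'u set"
    and l :: "'x \<Rightarrow> 'u \<Rightarrow> real" and Vf :: "'x \<Rightarrow> real" +
  fixes \<sigma> W :: "'x \<Rightarrow> real" and \<gamma> :: "nat \<Rightarrow> real" and \<epsilon> \<gamma>o \<gamma>up :: real
  assumes sigma_nonneg: "0 \<le> \<sigma> x"
    and W_nonneg: "0 \<le> W x"
    and W_le: "W x \<le> \<gamma>o * \<sigma> x"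
    and eps_pos: "0 < \<epsilon>"
    and detectability: "u \<in> U \<Longrightarrow> W (f x u) - W x \<le> - \<epsilon> * \<sigma> x + l x u"
    and gamma_le: "1 \<le> k \<Longrightarrow> \<gamma> k \<le> \<gamma>up"
    and controllability: "1 \<le> k \<Longrightarrow> value_fn k x \<le> \<gamma> k * \<sigma> x"
begin

lemma value_fn_le_uniform: "1 \<le> k \<Longrightarrow> value_fn k x \<le> \<gamma>up * \<sigma> x"
  using controllability[of k x] mult_right_mono[OF gamma_le sigma_nonneg, of k x] by linarith

lemma value_fn_lower:
  assumes "1 \<le> k"
  shows "\<epsilon> * \<sigma> x \<le> value_fn k x + W x"
proof -
  obtain u where u: "optimal_input k x u"
    using minimizer_exists[OF assms] by blast
  have "l x (u 0) \<le> value_fn k x"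
  proof -
    have "l x (u 0) \<le> (\<Sum>j<k. l (trajectory f u x j) (u j))"
      using member_le_sum[of 0 "{..<k}" "\<lambda>j. l (trajectory f u x j) (u j)"] assms
        optimal_input_in[OF u] stage_cost_nonneg by auto
    then show ?thesis
      using terminal_cost_nonneg[of "trajectory f u x k"]
      unfolding value_fn_optimal[OF u] finite_cost_def by linarith
  qed
  moreover have "u 0 \<in> U"
    using optimal_input_in[OF u, of 0] assms by simp
  ultimately show ?thesis
    using detectability[of "u 0" x] W_nonneg[of "f x (u 0)"] by linarith
qed

text \<open>
  Relaxed dynamic programming. Detectability gives
  \<open>\<epsilon> * \<sigma> x \<le> W x - W (f x (\<kappa> x)) + l x (\<kappa> x)\<close>; since \<open>1 - \<alpha> \<ge> 0\<close>, inserting this into the assumed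
  decrease shows that \<open>\<alpha>\<close> times the stage cost is at most the decrease of \<open>V + (1 - \<alpha>) * W\<close>, and the
  sum over the closed loop telescopes.
\<close>
lemma closed_loop_cost_bound:
  assumes \<kappa>: "\<And>x. \<kappa> x \<in> U" and \<alpha>: "\<alpha> \<le> 1" and V_nonneg: "\<And>x. 0 \<le> V x"
    and decrease: "\<And>x. V (f x (\<kappa> x)) \<le> V x - l x (\<kappa> x) + (1 - \<alpha>) * \<epsilon> * \<sigma> x"
  shows "ereal \<alpha> * (closed_loop_cost f l \<kappa> x + ereal (W x)) \<le> ereal (V x + W x)"
proof -
  define z where "z = closed_loop f \<kappa> x"
  define a where "a = (\<lambda>k. l (z k) (\<kappa> (z k)))"
  define Z where "Z = (\<lambda>k. V (z k) + (1 - \<alpha>) * W (z k))"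
  have z_Suc: "z (Suc k) = f (z k) (\<kappa> (z k))" and z_0: "z 0 = x" for k
    by (auto simp: z_def)
  have a_nonneg: "0 \<le> a k" for k
    using \<kappa> stage_cost_nonneg by (auto simp: a_def)
  have cost: "closed_loop_cost f l \<kappa> x = (\<Sum>k. ereal (a k))"
    by (simp add: closed_loop_cost_def a_def z_def)
  have cost_nonneg: "0 \<le> closed_loop_cost f l \<kappa> x"
    unfolding cost using a_nonneg by (intro suminf_0_le) auto
  have step: "\<alpha> * a k \<le> Z k - Z (Suc k)" for k
  proof -
    have "(1 - \<alpha>) * (\<epsilon> * \<sigma> (z k)) \<le> (1 - \<alpha>) * (W (z k) - W (z (Suc k)) + a k)"
      using detectability[OF \<kappa>, of "z k" "z k"] \<alpha>
      by (intro mult_left_mono) (auto simp: z_Suc a_def)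
    then show ?thesis
      using decrease[of "z k"] by (auto simp: z_Suc a_def Z_def algebra_simps)
  qed
  have partial: "\<alpha> * (\<Sum>k<n. a k) \<le> V x + (1 - \<alpha>) * W x" for n
  proof -
    have "\<alpha> * (\<Sum>k<n. a k) \<le> (\<Sum>k<n. Z k - Z (Suc k))"
      unfolding sum_distrib_left by (intro sum_mono step)
    also have "\<dots> = Z 0 - Z n"
      by (induction n) auto
    also have "\<dots> \<le> Z 0"
    proof -
      have "0 \<le> Z n"
        unfolding Z_def using V_nonneg W_nonneg \<alpha> by (intro add_nonneg_nonneg mult_nonneg_nonneg) auto
      then show ?thesis
        by simp
    qed
    finally show ?thesis
      by (simp add: Z_def z_0)
  qed
  show ?thesis
  proof (cases "0 < \<alpha>")
    case True
    have "(\<Sum>k<n. ereal (a k)) + ereal (W x) \<le> ereal ((V x + W x) / \<alpha>)" for n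
      using partial[of n] True by (simp add: field_simps)
    then have "closed_loop_cost f l \<kappa> x + ereal (W x) \<le> ereal ((V x + W x) / \<alpha>)"
      unfolding cost using a_nonneg by (intro suminf_bound_add) auto
    then have "ereal \<alpha> * (closed_loop_cost f l \<kappa> x + ereal (W x))
        \<le> ereal \<alpha> * ereal ((V x + W x) / \<alpha>)"
      using True by (intro ereal_mult_left_mono) auto
    then show ?thesis
      using True by simp
  next
    case False
    have "ereal \<alpha> * (closed_loop_cost f l \<kappa> x + ereal (W x)) \<le> 0"
      using False cost_nonneg W_nonneg[of x] by (auto simp: ereal_mult_le_0_iff)
    also have "0 \<le> ereal (V x + W x)"
      using V_nonneg W_nonneg by simp
    finally show ?thesis .
  qed
qed

section \<open>The infinite-horizon value function\<close>

text \<open>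
  Summing detectability along an optimal trajectory bounds the sum of all \<open>\<sigma>\<close> values by a multiple
  of \<open>\<sigma> x\<close> that does not depend on the horizon. In a long horizon one of them is therefore small,
  and re-optimizing from that point is almost free.
\<close>
lemma long_horizon_decrease:
  assumes \<theta>: "0 < \<theta>" and up: "0 \<le> \<gamma>up"
  obtains M where "1 \<le> M"
    "\<And>x u. optimal_input M x u \<Longrightarrow>
       value_fn M (f x (u 0)) \<le> value_fn M x - l x (u 0) + \<theta> * \<epsilon> * \<sigma> x"
proof -
  \<comment> \<open>If \<open>n\<close> of the values \<open>\<sigma> (X j)\<close> exceeded \<open>\<theta> * \<epsilon> * \<sigma> x / \<gamma>up\<close>, their sum would violate the uniform bound
    \<open>(\<gamma>up + \<gamma>o) * \<sigma> x / \<epsilon>\<close>.\<close>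
  obtain n where n: "\<gamma>up * (\<gamma>up + \<gamma>o) / (\<theta> * \<epsilon> * \<epsilon>) < real n"
    using reals_Archimedean2 by blast
  define M where "M = Suc (Suc n)"
  have "value_fn M (f x (u 0)) \<le> value_fn M x - l x (u 0) + \<theta> * \<epsilon> * \<sigma> x"
    if u: "optimal_input M x u" for x u
  proof -
    define X where "X = trajectory f u x"
    have uU: "u j \<in> U" if "j < M" for j
      using optimal_input_in[OF u that] .
    have a_nonneg: "0 \<le> l (X j) (u j)" if "j < M" for j
      using uU[OF that] by (rule stage_cost_nonneg)
    have X0: "X 0 = x"
      by (simp add: X_def)
    have V: "value_fn M x = (\<Sum>j<M. l (X j) (u j)) + Vf (X M)"
      unfolding value_fn_optimal[OF u] by (simp add: finite_cost_def X_def)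
    have "(\<Sum>j<m. \<epsilon> * \<sigma> (X j)) \<le> W x - W (X m) + (\<Sum>j<m. l (X j) (u j))" if "m \<le> M" for m
      using that
    proof (induction m)
      case (Suc m)
      then show ?case
        using detectability[of "u m" "X m"] uU[of m] by (simp add: X_def)
    qed (simp add: X0)
    from this[of M] have "(\<Sum>j<M. \<epsilon> * \<sigma> (X j)) \<le> W x + value_fn M x"
      using W_nonneg[of "X M"] terminal_cost_nonneg[of "X M"] V by simp
    also have "\<dots> \<le> (\<gamma>up + \<gamma>o) * \<sigma> x"
      using value_fn_le_uniform[of M x] W_le[of x] by (simp add: M_def algebra_simps)
    finally have total: "(\<Sum>j<M. \<epsilon> * \<sigma> (X j)) \<le> (\<gamma>up + \<gamma>o) * \<sigma> x" .
    have "\<exists>j\<in>{1..Suc n}. \<gamma>up * \<sigma> (X j) \<le> \<theta> * \<epsilon> * \<sigma> x"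
    proof (rule ccontr)
      assume "\<not> ?thesis"
      then have big: "\<theta> * \<epsilon> * \<sigma> x < \<gamma>up * \<sigma> (X j)" if "j \<in> {1..Suc n}" for j
        using that by force
      have "(\<Sum>j=1..Suc n. \<epsilon> * (\<theta> * \<epsilon> * \<sigma> x)) < (\<Sum>j=1..Suc n. \<epsilon> * (\<gamma>up * \<sigma> (X j)))"
        using big eps_pos by (intro sum_strict_mono mult_strict_left_mono) auto
      also have "\<dots> = \<gamma>up * (\<Sum>j=1..Suc n. \<epsilon> * \<sigma> (X j))"
        by (simp add: sum_distrib_left algebra_simps)
      also have "\<dots> \<le> \<gamma>up * (\<Sum>j<M. \<epsilon> * \<sigma> (X j))"
        using eps_pos sigma_nonneg up
        by (intro mult_left_mono sum_mono2) (auto simp: M_def)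
      also have "\<dots> \<le> \<gamma>up * ((\<gamma>up + \<gamma>o) * \<sigma> x)"
        using total up by (rule mult_left_mono)
      finally have "real (Suc n) * (\<theta> * \<epsilon> * \<epsilon>) * \<sigma> x < \<gamma>up * (\<gamma>up + \<gamma>o) * \<sigma> x"
        by (simp add: algebra_simps)
      then have "real (Suc n) * (\<theta> * \<epsilon> * \<epsilon>) < \<gamma>up * (\<gamma>up + \<gamma>o)"
        by (rule mult_right_less_imp_less) (rule sigma_nonneg)
      moreover have "\<gamma>up * (\<gamma>up + \<gamma>o) < real n * (\<theta> * \<epsilon> * \<epsilon>)"
        using n \<theta> eps_pos by (simp add: pos_divide_less_eq)
      moreover have "real n * (\<theta> * \<epsilon> * \<epsilon>) \<le> real (Suc n) * (\<theta> * \<epsilon> * \<epsilon>)"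
        using \<theta> eps_pos by (intro mult_right_mono) auto
      ultimately show False
        by linarith
    qed
    then obtain m where m: "Suc m \<le> Suc n" and small: "\<gamma>up * \<sigma> (X (Suc m)) \<le> \<theta> * \<epsilon> * \<sigma> x"
      by (metis One_nat_def Suc_le_D atLeastAtMost_iff)
    have "value_fn M (f x (u 0)) \<le>
        (\<Sum>j=1..<Suc m. l (X j) (u j)) + value_fn (M - m) (X (Suc m))"
      unfolding X_def using m by (intro value_fn_successor_le[OF u]) (auto simp: M_def)
    also have "(\<Sum>j=1..<Suc m. l (X j) (u j)) \<le> (\<Sum>j=1..<M. l (X j) (u j))"
      using m a_nonneg by (intro sum_mono2) (auto simp: M_def)
    also have "(\<Sum>j=1..<M. l (X j) (u j)) = (\<Sum>j<M. l (X j) (u j)) - l x (u 0)"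
      by (simp add: lessThan_atLeast0 sum.atLeast_Suc_lessThan M_def X0)
    also have "\<dots> \<le> value_fn M x - l x (u 0)"
      using V terminal_cost_nonneg by simp
    also have "value_fn (M - m) (X (Suc m)) \<le> \<gamma>up * \<sigma> (X (Suc m))"
      using m by (intro value_fn_le_uniform) (auto simp: M_def)
    finally show ?thesis
      using small by simp
  qed
  then show thesis
    by (intro that[of M]) (auto simp: M_def)
qed

text \<open>
  Cost controllability speaks of finite horizons only. It carries over to the infinite horizon
  because a receding-horizon feedback with a long horizon is a relaxed dynamic programming feedback
  with \<open>\<alpha>\<close> as close to \<open>1\<close> as desired, so that its cost bounds the infinite-horizon value.
\<close>
lemma infinite_value_le:
  assumes up: "0 \<le> \<gamma>up"
  shows "infinite_value f U l x + ereal (W x) \<le> ereal ((\<gamma>up + \<gamma>o) * \<sigma> x)"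
proof (rule ereal_le_mult_one_interval)
  fix e :: ereal
  assume "0 < e" "e < 1"
  then obtain \<alpha> where e: "e = ereal \<alpha>" and \<alpha>: "0 < \<alpha>" "\<alpha> < 1"
    by (cases e) auto
  obtain M where M: "1 \<le> M" and decrease: "\<And>x u. optimal_input M x u \<Longrightarrow>
      value_fn M (f x (u 0)) \<le> value_fn M x - l x (u 0) + (1 - \<alpha>) * \<epsilon> * \<sigma> x"
    using \<alpha> up by (auto intro: long_horizon_decrease[of "1 - \<alpha>"])
  define v where "v = (\<lambda>x. SOME u. optimal_input M x u)"
  define \<kappa> where "\<kappa> = (\<lambda>x. v x 0)"
  have v: "optimal_input M x (v x)" for x
    unfolding v_def using minimizer_exists[OF M] by (rule someI_ex)
  have \<kappa>: "\<kappa> x \<in> U" for x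
    unfolding \<kappa>_def using optimal_input_in[OF v] M by simp
  have "e * (infinite_value f U l x + ereal (W x)) \<le> e * (closed_loop_cost f l \<kappa> x + ereal (W x))"
    using \<kappa> \<alpha> unfolding e
    by (intro ereal_mult_left_mono add_right_mono infinite_value_le_closed_loop_cost) auto
  also have "\<dots> \<le> ereal (value_fn M x + W x)"
    unfolding e
  proof (rule closed_loop_cost_bound[OF \<kappa>])
    show "value_fn M (f x (\<kappa> x)) \<le> value_fn M x - l x (\<kappa> x) + (1 - \<alpha>) * \<epsilon> * \<sigma> x" for x
      using decrease[OF v] by (simp add: \<kappa>_def)
  qed (use \<alpha> value_fn_nonneg[OF M] in auto)
  also have "\<dots> \<le> ereal ((\<gamma>up + \<gamma>o) * \<sigma> x)"
    using value_fn_le_uniform[OF M, of x] W_le[of x] by (simp add: algebra_simps)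
  finally show "e * (infinite_value f U l x + ereal (W x)) \<le> ereal ((\<gamma>up + \<gamma>o) * \<sigma> x)" .
qed auto

text \<open>
  Concatenation for the infinite horizon, combined with the bound above: along an input whose cost
  exceeds a lower bound \<open>v\<close> of all costs by less than \<open>\<delta>\<close>, every tail is nearly optimal for its own initial state.
  The second \<open>\<delta>\<close> pays for an only nearly optimal continuation.
\<close>
lemma tail_cost_le:
  assumes up: "0 \<le> \<gamma>up" and u: "u \<in> UNIV \<rightarrow> U" and \<delta>: "0 < \<delta>"
    and v: "ereal v \<le> infinite_value f U l x"
    and s: "(\<lambda>k. l (trajectory f u x k) (u k)) sums s" "s < v + \<delta>"
  shows "s - (\<Sum>j<m. l (trajectory f u x j) (u j)) + W (trajectory f u x m)
    \<le> (\<gamma>up + \<gamma>o) * \<sigma> (trajectory f u x m) + 2 * \<delta>"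
proof -
  define y where "y = trajectory f u x m"
  define c where "c = (\<gamma>up + \<gamma>o) * \<sigma> y - W y"
  have "infinite_value f U l y \<le> ereal c"
    using infinite_value_le[OF up, of y] by (cases "infinite_value f U l y") (auto simp: c_def)
  then have "infinite_value f U l y < ereal (c + \<delta>)"
    using \<delta> by (auto elim: le_less_trans)
  then obtain w t where w: "w \<in> UNIV \<rightarrow> U" and t: "(\<lambda>k. l (trajectory f w y k) (w k)) sums t"
    and t_less: "t < c + \<delta>"
    by (rule infinite_value_lessE)
  define z where "z = (\<lambda>j. if j < m then u j else w (j - m))"
  have z: "z \<in> UNIV \<rightarrow> U"
    using u w by (auto simp: z_def Pi_iff)
  have traj: "trajectory f z x j = trajectory f u x j" if "j \<le> m" for j
    using that by (intro trajectory_cong) (auto simp: z_def)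
  have traj_tail: "trajectory f z x (j + m) = trajectory f w y j" for j
    using trajectory_add[of f z x m j] traj[of m] by (simp add: z_def y_def add.commute)
  have "(\<lambda>j. l (trajectory f z x (j + m)) (z (j + m))) sums t"
    using t by (simp add: traj_tail) (simp add: z_def)
  then have "(\<lambda>j. l (trajectory f z x j) (z j)) sums
      (t + (\<Sum>j<m. l (trajectory f z x j) (z j)))"
    by (subst (asm) sums_iff_shift)
  also have "(\<Sum>j<m. l (trajectory f z x j) (z j)) = (\<Sum>j<m. l (trajectory f u x j) (u j))"
  proof (rule sum.cong)
    fix j assume "j \<in> {..<m}"
    then have "trajectory f z x j = trajectory f u x j" "z j = u j"
      using traj[of j] by (auto simp: z_def)
    then show "l (trajectory f z x j) (z j) = l (trajectory f u x j) (u j)"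
      by simp
  qed simp
  finally have "infinite_cost f l x z = ereal (t + (\<Sum>j<m. l (trajectory f u x j) (u j)))"
    by (rule infinite_cost_sums)
  moreover have "infinite_value f U l x \<le> infinite_cost f l x z"
    unfolding infinite_value_def using z by (rule INF_lower)
  ultimately have "ereal v \<le> ereal (t + (\<Sum>j<m. l (trajectory f u x j) (u j)))"
    using v by (simp del: ereal_less_eq)
  then have "v \<le> t + (\<Sum>j<m. l (trajectory f u x j) (u j))"
    by simp
  then show ?thesis
    using t_less s(2) by (simp add: y_def c_def)
qed

text \<open>
  Turnpike-type comparison. Along a nearly optimal infinite input, the remaining cost plus \<open>W\<close>
  decreases by \<open>\<epsilon> * \<sigma>\<close> per step and is bounded by \<open>(\<gamma>up + \<gamma>o) * \<sigma>\<close>, hence decays geometrically.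
  Cutting the input at time \<open>N\<close> and paying the terminal cost, which is at most \<open>c * \<sigma>\<close>, thus costs
  an exponentially small fraction of the infinite-horizon value.
\<close>
lemma finite_value_le_infinite_value:
  assumes up: "0 \<le> \<gamma>up" and \<Gamma>: "\<epsilon> \<le> \<gamma>up + \<gamma>o"
    and c: "0 \<le> c" and Vf_le: "\<And>x. Vf x \<le> c * \<sigma> x"
  shows "ereal (value_fn N x + W x) \<le>
    ereal (1 + c / \<epsilon> * (1 - \<epsilon> / (\<gamma>up + \<gamma>o)) ^ N) * (infinite_value f U l x + ereal (W x))"
proof -
  define \<Gamma>' where "\<Gamma>' = \<gamma>up + \<gamma>o"
  define \<rho> where "\<rho> = 1 - \<epsilon> / \<Gamma>'"
  have \<Gamma>'_pos: "0 < \<Gamma>'"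
    using \<Gamma> eps_pos by (simp add: \<Gamma>'_def)
  have \<rho>: "0 \<le> \<rho>" "\<rho> \<le> 1"
    using \<Gamma> eps_pos \<Gamma>'_pos by (auto simp: \<rho>_def \<Gamma>'_def)
  obtain v where v: "infinite_value f U l x = ereal v"
    using infinite_value_le[OF up, of x] infinite_value_nonneg[of x]
    by (cases "infinite_value f U l x") auto
  have approx: "value_fn N x + W x \<le> (1 + c / \<epsilon> * \<rho> ^ N) * (v + W x)
      + (1 + c / \<epsilon> * (\<rho> ^ N + 2 * real N)) * \<delta>" if \<delta>: "0 < \<delta>" for \<delta>
  proof -
    have "infinite_value f U l x < ereal (v + \<delta>)"
      using v \<delta> by simp
    then obtain u s where u: "u \<in> UNIV \<rightarrow> U"
      and s: "(\<lambda>k. l (trajectory f u x k) (u k)) sums s" "s < v + \<delta>"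
      by (rule infinite_value_lessE)
    define X where "X = trajectory f u x"
    \<comment> \<open>the cost that remains after \<open>k\<close> steps, plus \<open>W\<close>\<close>
    define T where "T = (\<lambda>k. s - (\<Sum>j<k. l (X j) (u j)) + W (X k))"
    have a_nonneg: "0 \<le> l (X j) (u j)" for j
      using u by (auto intro: stage_cost_nonneg)
    have partial_le: "(\<Sum>j<k. l (X j) (u j)) \<le> s" for k
      using sum_le_suminf[of "\<lambda>j. l (X j) (u j)" "{..<k}"] s(1) a_nonneg
      by (simp add: sums_iff X_def)
    have T_Suc: "T (Suc k) \<le> T k - \<epsilon> * \<sigma> (X k)" for k
      using detectability[of "u k" "X k"] u by (simp add: T_def X_def Pi_iff)
    have T_le: "T k \<le> \<Gamma>' * \<sigma> (X k) + 2 * \<delta>" for k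
      using tail_cost_le[OF up u \<delta> _ s, of k] v by (simp add: T_def X_def \<Gamma>'_def)
    have T_step: "T (Suc k) \<le> \<rho> * T k + 2 * \<delta>" for k
    proof -
      have "\<epsilon> / \<Gamma>' * (T k - 2 * \<delta>) \<le> \<epsilon> / \<Gamma>' * (\<Gamma>' * \<sigma> (X k))"
        using T_le[of k] eps_pos \<Gamma>'_pos by (intro mult_left_mono) auto
      moreover have "\<epsilon> / \<Gamma>' * (2 * \<delta>) \<le> 1 * (2 * \<delta>)"
        using \<Gamma> \<delta> \<Gamma>'_pos by (intro mult_right_mono) (auto simp: \<Gamma>'_def)
      ultimately show ?thesis
        using T_Suc[of k] \<Gamma>'_pos by (simp add: \<rho>_def algebra_simps)
    qed
    have T_decay: "T k \<le> \<rho> ^ k * T 0 + 2 * real k * \<delta>" for k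
    proof (induction k)
      case (Suc k)
      have "T (Suc k) \<le> \<rho> * (\<rho> ^ k * T 0 + 2 * real k * \<delta>) + 2 * \<delta>"
        using T_step[of k] mult_left_mono[OF Suc \<rho>(1)] by linarith
      moreover have "\<rho> * (2 * real k * \<delta>) \<le> 1 * (2 * real k * \<delta>)"
        using \<rho>(2) \<delta> by (intro mult_right_mono) auto
      ultimately show ?case
        by (simp add: algebra_simps)
    qed simp
    have "\<epsilon> * \<sigma> (X N) \<le> T N"
      using T_Suc[of N] partial_le[of "Suc N"] W_nonneg[of "X (Suc N)"] unfolding T_def by linarith
    also have "\<dots> \<le> \<rho> ^ N * T 0 + 2 * real N * \<delta>"
      by (rule T_decay)
    also have "\<dots> \<le> \<rho> ^ N * (v + W x + \<delta>) + 2 * real N * \<delta>"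
      using s(2) \<rho>(1) by (intro add_right_mono mult_left_mono) (auto simp: T_def X_def)
    finally have "c / \<epsilon> * (\<epsilon> * \<sigma> (X N)) \<le> c / \<epsilon> * (\<rho> ^ N * (v + W x + \<delta>) + 2 * real N * \<delta>)"
      using c eps_pos by (intro mult_left_mono) auto
    then have terminal: "Vf (X N) \<le> c / \<epsilon> * (\<rho> ^ N * (v + W x + \<delta>) + 2 * real N * \<delta>)"
      using Vf_le[of "X N"] eps_pos by simp
    have "value_fn N x \<le> finite_cost f l Vf N x u"
      using u by (intro value_fn_le_cost) auto
    also have "\<dots> = (\<Sum>j<N. l (X j) (u j)) + Vf (X N)"
      by (simp add: finite_cost_def X_def)
    finally show ?thesis
      using terminal partial_le[of N] s(2) by (simp add: algebra_simps add_divide_distrib)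
  qed
  have "((\<lambda>\<delta>. (1 + c / \<epsilon> * \<rho> ^ N) * (v + W x)
      + (1 + c / \<epsilon> * (\<rho> ^ N + 2 * real N)) * \<delta>) \<longlongrightarrow>
      (1 + c / \<epsilon> * \<rho> ^ N) * (v + W x) + (1 + c / \<epsilon> * (\<rho> ^ N + 2 * real N)) * 0) (at_right 0)"
    by (intro tendsto_intros)
  then have "value_fn N x + W x \<le> (1 + c / \<epsilon> * \<rho> ^ N) * (v + W x)
      + (1 + c / \<epsilon> * (\<rho> ^ N + 2 * real N)) * 0"
  proof (rule tendsto_lowerbound)
    show "\<forall>\<^sub>F \<delta> in at_right 0. value_fn N x + W x \<le> (1 + c / \<epsilon> * \<rho> ^ N) * (v + W x)
        + (1 + c / \<epsilon> * (\<rho> ^ N + 2 * real N)) * \<delta>"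
      using eventually_at_right_less[of "0 :: real"] by eventually_elim (rule approx)
  qed simp
  then show ?thesis
    by (simp add: v \<rho>_def \<Gamma>'_def)
qed

section \<open>The linear program\<close>

text \<open>
  The constraints of the linear program are inequalities that hold along every optimal trajectory,
  divided by \<open>\<sigma> x\<close>, with \<open>V\<close> standing for the value at the successor state: tails of
  optimal inputs are optimal, and the bounds on \<open>V\<close> come from re-optimizing after \<open>k\<close> steps, or
  appending one step to the whole optimal input.
\<close>
lemma optimal_trajectory_lp_feasible:
  assumes pos: "0 < \<sigma> x" and N: "1 \<le> N" and u: "optimal_input N x u"
    and W_ge: "\<And>x. \<gamma>low * \<sigma> x \<le> W x"
    and terminal_bounds: "\<And>x. c_low * \<sigma> x \<le> Vf x" "\<And>x. Vf x \<le> c_up * \<sigma> x"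
    and terminal_step: "\<And>x. \<exists>u\<in>U. Vf (f x u) + l x u \<le> (1 + \<epsilon>f) * Vf x"
  shows "lp_feasible N \<epsilon> \<gamma>low \<gamma>o \<gamma> c_low c_up \<epsilon>f
    (\<lambda>k. l (trajectory f u x k) (u k) / \<sigma> x) (\<lambda>k. W (trajectory f u x k) / \<sigma> x)
    (\<lambda>k. \<sigma> (trajectory f u x k) / \<sigma> x) (value_fn N (f x (u 0)) / \<sigma> x)
    (Vf (trajectory f u x N) / \<sigma> x)"
proof -
  define X where "X = trajectory f u x"
  define V where "V = value_fn N (f x (u 0))"
  have uU: "u j \<in> U" if "j < N" for j
    using optimal_input_in[OF u that] .
  have X0: "X 0 = x" and X_Suc: "X (Suc k) = f (X k) (u k)" for k
    by (auto simp: X_def)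
  have scale: "a / \<sigma> x \<le> b / \<sigma> x" if "a \<le> b" for a b
    using that pos by (simp add: divide_right_mono)
  have tail: "(\<Sum>j=k..<N. l (X j) (u j)) + Vf (X N) \<le> \<gamma> (N - k) * \<sigma> (X k)" if k: "k < N" for k
  proof -
    have "optimal_input (k + (N - k)) x u"
      using u k by simp
    then have "finite_cost f l Vf (N - k) (X k) (\<lambda>j. u (k + j)) = value_fn (N - k) (X k)"
      unfolding X_def using k by (intro optimal_tail) auto
    moreover have "finite_cost f l Vf (N - k) (X k) (\<lambda>j. u (k + j))
        = (\<Sum>j<N - k. l (X (k + j)) (u (k + j))) + Vf (X N)"
      using k by (simp add: finite_cost_def X_def flip: trajectory_add)
    moreover have "(\<Sum>j<N - k. l (X (k + j)) (u (k + j))) = (\<Sum>j=k..<N. l (X j) (u j))"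
      using sum.shift_bounds_nat_ivl[of "\<lambda>j. l (X j) (u j)" 0 k "N - k"] k
      by (simp add: lessThan_atLeast0 add.commute)
    ultimately show ?thesis
      using controllability[of "N - k" "X k"] k by simp
  qed
  have successor: "V \<le> (\<Sum>j=1..<k. l (X j) (u j)) + \<gamma> (N - k + 1) * \<sigma> (X k)"
    if k: "1 \<le> k" "k \<le> N" for k
  proof -
    obtain m where m: "k = Suc m"
      using k(1) by (cases k) auto
    have "N - k + 1 = N - m"
      using k m by simp
    then show ?thesis
      using value_fn_successor_le[OF u, of m] controllability[of "N - m" "X k"] k(2)
      unfolding X_def V_def m by simp
  qed
  have append: "V \<le> (\<Sum>j=1..<N. l (X j) (u j)) + (1 + \<epsilon>f) * Vf (X N)"
  proof -
    obtain w where w: "w \<in> U" "Vf (f (X N) w) + l (X N) w \<le> (1 + \<epsilon>f) * Vf (X N)"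
      using terminal_step by blast
    have "value_fn 1 (X N) \<le> finite_cost f l Vf 1 (X N) (\<lambda>_. w)"
      using w by (intro value_fn_le_cost) auto
    then have "value_fn 1 (X N) \<le> (1 + \<epsilon>f) * Vf (X N)"
      using w by (simp add: finite_cost_def)
    moreover have "V \<le> (\<Sum>j=1..<N. l (X j) (u j)) + value_fn 1 (X N)"
      using value_fn_successor_le[OF u, of "N - 1"] N by (simp add: X_def V_def)
    ultimately show ?thesis
      by linarith
  qed
  show ?thesis
    unfolding lp_feasible_def X_def[symmetric] V_def[symmetric]
  proof (intro conjI ballI)
    show "\<sigma> (X 0) / \<sigma> x = 1"
      using pos by (simp add: X0)
  next
    fix k assume k: "k \<in> {0..<N}"
    show "0 \<le> l (X k) (u k) / \<sigma> x"
      using k uU pos by (simp add: stage_cost_nonneg)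
    show "W (X (k + 1)) / \<sigma> x - W (X k) / \<sigma> x \<le> - \<epsilon> * (\<sigma> (X k) / \<sigma> x) + l (X k) (u k) / \<sigma> x"
      using scale[OF detectability[OF uU, of k "X k"]] k
      by (simp add: X_Suc diff_divide_distrib add_divide_distrib)
    show "(\<Sum>j=k..<N. l (X j) (u j) / \<sigma> x) + Vf (X N) / \<sigma> x \<le> \<gamma> (N - k) * (\<sigma> (X k) / \<sigma> x)"
      using scale[OF tail[of k]] k by (simp add: add_divide_distrib sum_divide_distrib)
  next
    fix k
    show "0 \<le> \<sigma> (X k) / \<sigma> x" "0 \<le> W (X k) / \<sigma> x"
      using pos by (simp_all add: sigma_nonneg W_nonneg)
    show "\<gamma>low * (\<sigma> (X k) / \<sigma> x) \<le> W (X k) / \<sigma> x"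
      using scale[OF W_ge[of "X k"]] by simp
    show "W (X k) / \<sigma> x \<le> \<gamma>o * (\<sigma> (X k) / \<sigma> x)"
      using scale[OF W_le[of "X k"]] by simp
  next
    fix k assume k: "k \<in> {1..N}"
    show "V / \<sigma> x \<le> (\<Sum>j=1..<k. l (X j) (u j) / \<sigma> x) + \<gamma> (N - k + 1) * (\<sigma> (X k) / \<sigma> x)"
      using scale[OF successor[of k]] k by (simp add: add_divide_distrib sum_divide_distrib)
  next
    show "V / \<sigma> x \<le> (\<Sum>j=1..<N. l (X j) (u j) / \<sigma> x) + (1 + \<epsilon>f) * (Vf (X N) / \<sigma> x)"
      using scale[OF append] by (simp add: add_divide_distrib sum_divide_distrib)
    show "c_low * (\<sigma> (X N) / \<sigma> x) \<le> Vf (X N) / \<sigma> x"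
      using scale[OF terminal_bounds(1)[of "X N"]] by simp
    show "Vf (X N) / \<sigma> x \<le> c_up * (\<sigma> (X N) / \<sigma> x)"
      using scale[OF terminal_bounds(2)[of "X N"]] by simp
    show "0 \<le> Vf (X N) / \<sigma> x"
      using pos terminal_cost_nonneg by simp
  qed
qed

text \<open>
  If \<open>\<sigma> x\<close> is positive, the normalized optimal trajectory is feasible, and multiplying the lower bound
  for its objective value by \<open>\<sigma> x\<close> gives the decrease. If \<open>\<sigma> x = 0\<close>, all costs along the optimal
  trajectory vanish, and so does the value at the successor state.
\<close>
lemma lp_decrease:
  assumes N: "1 \<le> N" and u: "optimal_input N x u"
    and W_ge: "\<And>x. \<gamma>low * \<sigma> x \<le> W x"
    and terminal_bounds: "\<And>x. c_low * \<sigma> x \<le> Vf x" "\<And>x. Vf x \<le> c_up * \<sigma> x"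
    and terminal_step: "\<And>x. \<exists>u\<in>U. Vf (f x u) + l x u \<le> (1 + \<epsilon>f) * Vf x"
    and lower: "\<And>w. w \<in> lp_objective_values N \<epsilon> \<gamma>low \<gamma>o \<gamma> c_low c_up \<epsilon>f \<Longrightarrow> (\<alpha> - 1) * \<epsilon> \<le> w"
  shows "value_fn N (f x (u 0)) \<le> value_fn N x - l x (u 0) + (1 - \<alpha>) * \<epsilon> * \<sigma> x"
proof -
  define X where "X = trajectory f u x"
  have X0: "X 0 = x"
    by (simp add: X_def)
  have a_nonneg: "0 \<le> l (X j) (u j)" if "j < N" for j
    using optimal_input_in[OF u that] by (rule stage_cost_nonneg)
  have V: "value_fn N x = l x (u 0) + (\<Sum>j=1..<N. l (X j) (u j)) + Vf (X N)"
    unfolding value_fn_optimal[OF u] using N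
    by (simp add: finite_cost_def X_def lessThan_atLeast0 sum.atLeast_Suc_lessThan)
  show ?thesis
  proof (cases "\<sigma> x = 0")
    case False
    then have pos: "0 < \<sigma> x"
      using sigma_nonneg[of x] by linarith
    have "(\<Sum>k=1..<N. l (X k) (u k) / \<sigma> x) + Vf (X N) / \<sigma> x - value_fn N (f x (u 0)) / \<sigma> x
        \<in> lp_objective_values N \<epsilon> \<gamma>low \<gamma>o \<gamma> c_low c_up \<epsilon>f"
      unfolding lp_objective_values_def X_def
      using optimal_trajectory_lp_feasible[OF pos N u W_ge terminal_bounds terminal_step] by blast
    from lower[OF this]
    have "(\<alpha> - 1) * \<epsilon> \<le>
        ((\<Sum>k=1..<N. l (X k) (u k)) + Vf (X N) - value_fn N (f x (u 0))) / \<sigma> x"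
      by (simp add: sum_divide_distrib add_divide_distrib diff_divide_distrib)
    then have "(\<alpha> - 1) * \<epsilon> * \<sigma> x \<le>
        (\<Sum>k=1..<N. l (X k) (u k)) + Vf (X N) - value_fn N (f x (u 0))"
      using pos by (simp add: pos_le_divide_eq)
    then show ?thesis
      using V by (simp add: algebra_simps)
  next
    case True
    have sum_nonneg': "0 \<le> (\<Sum>j=1..<N. l (X j) (u j))"
      using a_nonneg by (intro sum_nonneg) auto
    have "value_fn N x \<le> 0"
      using controllability[OF N, of x] True by simp
    then have zero: "value_fn N x = l x (u 0)" "(\<Sum>j=1..<N. l (X j) (u j)) = 0" "Vf (X N) = 0"
      using V sum_nonneg' terminal_cost_nonneg[of "X N"] a_nonneg[of 0] N by (auto simp: X0)
    obtain w where w: "w \<in> U" "Vf (f (X N) w) + l (X N) w \<le> (1 + \<epsilon>f) * Vf (X N)"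
      using terminal_step by blast
    have "value_fn N (f x (u 0)) \<le> (\<Sum>j=1..<N. l (X j) (u j)) + value_fn 1 (X N)"
      using value_fn_successor_le[OF u, of "N - 1"] N by (simp add: X_def)
    also have "value_fn 1 (X N) \<le> finite_cost f l Vf 1 (X N) (\<lambda>_. w)"
      using w by (intro value_fn_le_cost) auto
    also have "\<dots> \<le> 0"
      using w zero by (simp add: finite_cost_def)
    finally show ?thesis
      using zero True by simp
  qed
qed

end

lemma lp_feasible_initial:
  assumes N: "1 \<le> N"
    and feasible: "lp_feasible N \<epsilon> \<gamma>low \<gamma>o \<gamma> c_low c_up \<epsilon>f l W s V Vf"
  shows "s 0 = 1" "0 \<le> l 0" "l 0 \<le> \<gamma> N" "0 \<le> W 0" "0 \<le> W 1"
    "\<gamma>low \<le> W 0" "W 0 \<le> \<gamma>o" "W 1 - W 0 \<le> - \<epsilon> + l 0"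
proof -
  note constraints = feasible[unfolded lp_feasible_def]
  have zero: "0 \<in> {0..<N}" "0 \<in> {0..N}" "1 \<in> {0..N}"
    using N by auto
  show s0: "s 0 = 1"
    using constraints by blast
  have l_nonneg: "\<forall>k\<in>{0..<N}. 0 \<le> l k" and Vf: "0 \<le> Vf"
    using constraints by blast+
  have sW_nonneg: "\<forall>k\<in>{0..N}. 0 \<le> s k \<and> 0 \<le> W k"
    and W_bounds: "\<forall>k\<in>{0..N}. \<gamma>low * s k \<le> W k \<and> W k \<le> \<gamma>o * s k"
    using constraints by blast+
  have dissipation: "\<forall>k\<in>{0..<N}. W (k + 1) - W k \<le> - \<epsilon> * s k + l k"
    and cost: "\<forall>k\<in>{0..<N}. (\<Sum>j=k..<N. l j) + Vf \<le> \<gamma> (N - k) * s k"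
    using constraints by blast+
  show "0 \<le> l 0" "0 \<le> W 0" "0 \<le> W 1"
    using l_nonneg sW_nonneg zero by blast+
  show "\<gamma>low \<le> W 0" "W 0 \<le> \<gamma>o"
    using W_bounds[rule_format, OF zero(2)] s0 by auto
  show "W 1 - W 0 \<le> - \<epsilon> + l 0"
    using dissipation[rule_format, OF zero(1)] s0 by simp
  have "l 0 \<le> (\<Sum>j=0..<N. l j)"
    using zero l_nonneg by (intro member_le_sum) auto
  then show "l 0 \<le> \<gamma> N"
    using cost[rule_format, OF zero(1)] Vf s0 by simp
qed

text \<open>
  From any feasible point another one with objective value \<open>0\<close> arises by setting everything after
  time \<open>0\<close> to zero; this only relaxes the dissipation and cost constraints at time \<open>0\<close>, and all later
  ones become trivial. Hence the minimum is nonpositive, which means \<open>\<alpha> \<le> 1\<close>.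
\<close>
lemma zero_in_lp_objective_values:
  assumes N: "1 \<le> N"
    and feasible: "lp_feasible N \<epsilon> \<gamma>low \<gamma>o \<gamma> c_low c_up \<epsilon>f l W s V Vf"
  shows "0 \<in> lp_objective_values N \<epsilon> \<gamma>low \<gamma>o \<gamma> c_low c_up \<epsilon>f"
proof -
  define cut where "cut = (\<lambda>(a :: nat \<Rightarrow> real) (k :: nat). if k = 0 then a 0 else 0)"
  have sum_cut: "(\<Sum>j=k..<n. cut l j) = (if k = 0 \<and> 0 < n then l 0 else 0)" for k n
    by (simp add: cut_def sum.delta)
  note initial = lp_feasible_initial[OF N feasible]
  have "lp_feasible N \<epsilon> \<gamma>low \<gamma>o \<gamma> c_low c_up \<epsilon>f (cut l) (cut W) (cut s) 0 0"
    unfolding lp_feasible_def sum_cut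
    using N initial by (auto simp: cut_def)
  moreover have "(\<Sum>k=1..<N. cut l k) + 0 - 0 = 0"
    by (simp add: sum_cut)
  ultimately show ?thesis
    unfolding lp_objective_values_def mem_Collect_eq by metis
qed

text \<open>
  Dissipation and the total cost constraint, both at time \<open>0\<close>, cannot hold together unless \<open>\<epsilon>\<close> is
  small. This keeps the contraction factor in the performance bound nonnegative, even if \<open>\<sigma>\<close>
  vanishes identically and the system itself says nothing about the constants.
\<close>
lemma lp_feasible_eps_le:
  assumes N: "1 \<le> N"
    and feasible: "lp_feasible N \<epsilon> \<gamma>low \<gamma>o \<gamma> c_low c_up \<epsilon>f l W s V Vf"
  shows "\<epsilon> \<le> \<gamma> N + \<gamma>o"
  using lp_feasible_initial[OF N feasible] by linarith

section \<open>Stability and performance\<close>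

theorem theorem6:
  fixes f :: "real ^ 'n \<Rightarrow> real ^ 'm \<Rightarrow> real ^ 'n"
    and U :: "(real ^ 'm) set"
    and l :: "real ^ 'n \<Rightarrow> real ^ 'm \<Rightarrow> real"
    and Vf \<sigma> W :: "real ^ 'n \<Rightarrow> real"
    and N :: nat
    and ustar :: "real ^ 'n \<Rightarrow> nat \<Rightarrow> real ^ 'm"
    and \<gamma>f :: "nat \<Rightarrow> real"
    and eps_o gam_o_low gam_o_up gam_f_up c_low c_up eps_f \<alpha> :: real
  assumes horizon: "N \<ge> 1"
    and l_nonneg: "\<forall>x. \<forall>u\<in>U. l x u \<ge> 0"
    and Vf_nonneg: "\<forall>x. Vf x \<ge> 0"
    and sigma_nonneg: "\<forall>x. \<sigma> x \<ge> 0"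
    and minimizers_exist:
      "\<forall>k\<ge>1. \<forall>x. \<exists>u. is_arg_min (finite_cost f l Vf k x) (\<lambda>u. u \<in> input_seqs U k) u"
    and ustar_minimizer:
      "\<forall>x. is_arg_min (finite_cost f l Vf N x) (\<lambda>u. u \<in> input_seqs U N) (ustar x)"
    and W_nonneg: "\<forall>x. W x \<ge> 0"
    and detectability_constants: "eps_o > 0" "gam_o_low \<ge> 0" "gam_o_up \<ge> 0"
    and detectability_bounds: "\<forall>x. gam_o_low * \<sigma> x \<le> W x \<and> W x \<le> gam_o_up * \<sigma> x"
    and detectability_decrease: "\<forall>x. \<forall>u\<in>U. W (f x u) - W x \<le> - eps_o * \<sigma> x + l x u"
    and controllability_constants:
      "gam_f_up \<ge> 0" "\<forall>k\<ge>1. 0 \<le> \<gamma>f k \<and> \<gamma>f k \<le> gam_f_up"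
    and controllability: "\<forall>x. \<forall>k\<ge>1. finite_value f U l Vf k x \<le> \<gamma>f k * \<sigma> x"
    and terminal_constants: "c_low > 0" "c_up > 0" "eps_f > 0"
    and terminal_bounds: "\<forall>x. c_low * \<sigma> x \<le> Vf x \<and> Vf x \<le> c_up * \<sigma> x"
    and terminal_decrease:
      "\<forall>x. \<exists>u. is_arg_min (\<lambda>u. Vf (f x u) + l x u) (\<lambda>u. u \<in> U) u \<and>
               Vf (f x u) + l x u \<le> (1 + eps_f) * Vf x"
    and terminal_gamma: "c_low \<le> \<gamma>f 1 / (1 + eps_f)" "\<gamma>f 1 / (1 + eps_f) \<le> c_up"
    and alpha_lp:
      "is_minimum (lp_objective_values N eps_o gam_o_low gam_o_up \<gamma>f c_low c_up eps_f)
         ((\<alpha> - 1) * eps_o)"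
  shows "(\<forall>x.
            eps_o * \<sigma> x \<le> finite_value f U l Vf N x + W x \<and>
            finite_value f U l Vf N x + W x \<le> (\<gamma>f N + gam_o_up) * \<sigma> x \<and>
            (finite_value f U l Vf N (f x (mpc_feedback ustar x)) + W (f x (mpc_feedback ustar x)))
              - (finite_value f U l Vf N x + W x) \<le> - eps_o * \<alpha> * \<sigma> x) \<and>
         (\<forall>x0.
            ereal \<alpha> * (closed_loop_cost f l (mpc_feedback ustar) x0 + ereal (W x0))
              \<le> ereal (1 + c_up / eps_o * (1 - eps_o / (gam_f_up + gam_o_up)) ^ N)
                 * (infinite_value f U l x0 + ereal (W x0)))"
proof -
  interpret detectable_controllable f U l Vf \<sigma> W \<gamma>f eps_o gam_o_up gam_f_up
    using l_nonneg Vf_nonneg minimizers_exist sigma_nonneg W_nonneg detectability_bounds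
      detectability_constants detectability_decrease controllability_constants controllability
    by unfold_locales auto
  define \<mu> where "\<mu> = mpc_feedback ustar"
  have ustar: "optimal_input N x (ustar x)" for x
    using ustar_minimizer by blast
  have \<mu>: "\<mu> x = ustar x 0" for x
    by (simp add: \<mu>_def mpc_feedback_def)
  have \<mu>_in: "\<mu> x \<in> U" for x
    using optimal_input_in[OF ustar, of 0] horizon by (simp add: \<mu>)
  have terminal_step: "\<exists>u\<in>U. Vf (f x u) + l x u \<le> (1 + eps_f) * Vf x" for x
    using terminal_decrease by (auto simp: is_arg_min_def)
  obtain l' W' s' V' Vf' where feasible:
    "lp_feasible N eps_o gam_o_low gam_o_up \<gamma>f c_low c_up eps_f l' W' s' V' Vf'"
    using alpha_lp unfolding is_minimum_def lp_objective_values_def by blast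
  have lower: "(\<alpha> - 1) * eps_o \<le> w"
    if "w \<in> lp_objective_values N eps_o gam_o_low gam_o_up \<gamma>f c_low c_up eps_f" for w
    using alpha_lp that by (auto simp: is_minimum_def)
  have "(\<alpha> - 1) * eps_o \<le> 0"
    using lower[OF zero_in_lp_objective_values[OF horizon feasible]] .
  then have \<alpha>: "\<alpha> \<le> 1"
    using detectability_constants(1) by (simp add: mult_le_0_iff)
  have \<Gamma>: "eps_o \<le> gam_f_up + gam_o_up"
    using lp_feasible_eps_le[OF horizon feasible] gamma_le[OF horizon] by linarith
  have decrease: "value_fn N (f x (\<mu> x)) \<le> value_fn N x - l x (\<mu> x) + (1 - \<alpha>) * eps_o * \<sigma> x" for x
    unfolding \<mu> using detectability_bounds terminal_bounds terminal_step lower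
    by (intro lp_decrease[OF horizon ustar]) auto
  have "eps_o * \<sigma> x \<le> value_fn N x + W x \<and>
      value_fn N x + W x \<le> (\<gamma>f N + gam_o_up) * \<sigma> x \<and>
      (value_fn N (f x (\<mu> x)) + W (f x (\<mu> x))) - (value_fn N x + W x) \<le> - eps_o * \<alpha> * \<sigma> x" for x
  proof (intro conjI)
    show "eps_o * \<sigma> x \<le> value_fn N x + W x"
      by (rule value_fn_lower[OF horizon])
    show "value_fn N x + W x \<le> (\<gamma>f N + gam_o_up) * \<sigma> x"
      using controllability[rule_format, OF horizon, of x] W_le[of x]
      by (simp add: algebra_simps)
    show "(value_fn N (f x (\<mu> x)) + W (f x (\<mu> x))) - (value_fn N x + W x) \<le> - eps_o * \<alpha> * \<sigma> x"
      using decrease[of x] detectability[OF \<mu>_in, of x x] by (simp add: algebra_simps)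
  qed
  moreover have "ereal \<alpha> * (closed_loop_cost f l \<mu> x0 + ereal (W x0))
      \<le> ereal (1 + c_up / eps_o * (1 - eps_o / (gam_f_up + gam_o_up)) ^ N)
         * (infinite_value f U l x0 + ereal (W x0))" for x0
  proof -
    have "ereal \<alpha> * (closed_loop_cost f l \<mu> x0 + ereal (W x0)) \<le> ereal (value_fn N x0 + W x0)"
      using \<mu>_in \<alpha> value_fn_nonneg[OF horizon] decrease by (rule closed_loop_cost_bound)
    also have "\<dots> \<le> ereal (1 + c_up / eps_o * (1 - eps_o / (gam_f_up + gam_o_up)) ^ N)
         * (infinite_value f U l x0 + ereal (W x0))"
      using controllability_constants(1) \<Gamma> terminal_constants(2) terminal_bounds
      by (intro finite_value_le_infinite_value) auto
    finally show ?thesis .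
  qed
  ultimately show ?thesis
    unfolding \<mu>_def by blast
qed

end
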